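(* The following five identities form a basis of independent identities for the variety of nearlattices $(L,m)$: \begin{align*} \text{(H1)}\quad & m(x,x,x) = x, \\ \text{(H2)}\quad & m(x,x,y) = m(y,y,x), \\ \text{(H4)}\quad & m(x,y,z) = m(y,x,z), \\ \text{(H7)}\quad & m(x,m(x,x,y),z) = m(x,x,z), \\ \text{(H8)}\quad & m(m(x,m(y,z,u),u),m(x,m(y,z,u),u),m(x,z,u)) = m(x,z,u). \end{align*} That is, a ternary algebra $(L,m)$ is a nearlattice if and only if it satisfies these five identities, and none of the five identities is a consequence of the other four. In particular, the five identities imply the identities \begin{align*} \text{(H3)}\quad & m(m(x,x,y),m(x,x,y),z) = m(x,x,m(y,y,z)), \\ \text{(H5)}\quad & m(m(x,y,z),m(x,y,z),m(x,x,z)) = m(x,x,z), \\ \text{(H6)}\quad & m(m(x,x,y),z,y) = m(x,z,y). \end{align*}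
   Context: A (order-theoretic) nearlattice is a join semilattice $(L,\lor)$ such that for each $a\in L$ the principal filter $\{x\in L \mid a\le x\}$ is a lattice with respect to the induced order (where $x\le y$ iff $x\lor y=y$); the meet of $x,y$ in this principal filter is denoted $x\land_a y$. To such a structure one associates the ternary operation $$m(x,y,z)=(x\lor z)\land_z(y\lor z),\qquad x,y,z\in L.$$ A ternary algebra $(L,m)$ is called a nearlattice if $m$ arises in this way from some order-theoretic nearlattice on the set $L$ (in which case the join is recovered by $x\lor y=m(x,x,y)$, and $x\land_a y=m(x,y,a)$ for $x,y\ge a$). The class of such ternary algebras is a variety. A basis of identities for a variety is a set of identities whose class of models is exactly that variety. A set of identities is independent if for each identity in it there is an algebra satisfying all the others but not that one. All identities are universally quantified over the algebra. *)

theory Defs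
  imports "HOL-Algebra.Lattice"
begin

section \<open>Order-theoretic nearlattices\<close>

definition join_semilattice :: "'a set \<Rightarrow> ('a \<Rightarrow> 'a \<Rightarrow> 'a) \<Rightarrow> bool" where
  "join_semilattice L j \<longleftrightarrow>
     (\<forall>x\<in>L. \<forall>y\<in>L. j x y \<in> L) \<and>
     (\<forall>x\<in>L. \<forall>y\<in>L. \<forall>z\<in>L. j (j x y) z = j x (j y z)) \<and>
     (\<forall>x\<in>L. \<forall>y\<in>L. j x y = j y x) \<and>
     (\<forall>x\<in>L. j x x = x)"

definition join_le :: "('a \<Rightarrow> 'a \<Rightarrow> 'a) \<Rightarrow> 'a \<Rightarrow> 'a \<Rightarrow> bool" where
  "join_le j x y \<longleftrightarrow> j x y = y"

definition principal_filter :: "'a set \<Rightarrow> ('a \<Rightarrow> 'a \<Rightarrow> 'a) \<Rightarrow> 'a \<Rightarrow> 'a gorder" where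
  "principal_filter L j a = \<lparr>carrier = {x \<in> L. join_le j a x}, eq = (=), le = join_le j\<rparr>"

definition order_nearlattice :: "'a set \<Rightarrow> ('a \<Rightarrow> 'a \<Rightarrow> 'a) \<Rightarrow> bool" where
  "order_nearlattice L j \<longleftrightarrow>
     join_semilattice L j \<and> (\<forall>a\<in>L. lattice (principal_filter L j a))"

definition nearlattice_op :: "'a set \<Rightarrow> ('a \<Rightarrow> 'a \<Rightarrow> 'a) \<Rightarrow> 'a \<Rightarrow> 'a \<Rightarrow> 'a \<Rightarrow> 'a" where
  "nearlattice_op L j x y z = j x z \<sqinter>\<^bsub>principal_filter L j z\<^esub> j y z"


section \<open>Ternary algebras\<close>

text \<open>Algebras have an explicit carrier; the empty carrier is not excluded.\<close>

definition ternary_algebra :: "'a set \<Rightarrow> ('a \<Rightarrow> 'a \<Rightarrow> 'a \<Rightarrow> 'a) \<Rightarrow> bool" where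
  "ternary_algebra L m \<longleftrightarrow> (\<forall>x\<in>L. \<forall>y\<in>L. \<forall>z\<in>L. m x y z \<in> L)"

definition nearlattice :: "'a set \<Rightarrow> ('a \<Rightarrow> 'a \<Rightarrow> 'a \<Rightarrow> 'a) \<Rightarrow> bool" where
  "nearlattice L m \<longleftrightarrow> ternary_algebra L m \<and>
     (\<exists>j. order_nearlattice L j \<and>
          (\<forall>x\<in>L. \<forall>y\<in>L. \<forall>z\<in>L. m x y z = nearlattice_op L j x y z))"


section \<open>The identities\<close>

definition H1 :: "'a set \<Rightarrow> ('a \<Rightarrow> 'a \<Rightarrow> 'a \<Rightarrow> 'a) \<Rightarrow> bool" where
  "H1 L m \<longleftrightarrow> (\<forall>x\<in>L. m x x x = x)"

definition H2 :: "'a set \<Rightarrow> ('a \<Rightarrow> 'a \<Rightarrow> 'a \<Rightarrow> 'a) \<Rightarrow> bool" where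
  "H2 L m \<longleftrightarrow> (\<forall>x\<in>L. \<forall>y\<in>L. m x x y = m y y x)"

definition H3 :: "'a set \<Rightarrow> ('a \<Rightarrow> 'a \<Rightarrow> 'a \<Rightarrow> 'a) \<Rightarrow> bool" where
  "H3 L m \<longleftrightarrow> (\<forall>x\<in>L. \<forall>y\<in>L. \<forall>z\<in>L.
     m (m x x y) (m x x y) z = m x x (m y y z))"

definition H4 :: "'a set \<Rightarrow> ('a \<Rightarrow> 'a \<Rightarrow> 'a \<Rightarrow> 'a) \<Rightarrow> bool" where
  "H4 L m \<longleftrightarrow> (\<forall>x\<in>L. \<forall>y\<in>L. \<forall>z\<in>L. m x y z = m y x z)"

definition H5 :: "'a set \<Rightarrow> ('a \<Rightarrow> 'a \<Rightarrow> 'a \<Rightarrow> 'a) \<Rightarrow> bool" where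
  "H5 L m \<longleftrightarrow> (\<forall>x\<in>L. \<forall>y\<in>L. \<forall>z\<in>L.
     m (m x y z) (m x y z) (m x x z) = m x x z)"

definition H6 :: "'a set \<Rightarrow> ('a \<Rightarrow> 'a \<Rightarrow> 'a \<Rightarrow> 'a) \<Rightarrow> bool" where
  "H6 L m \<longleftrightarrow> (\<forall>x\<in>L. \<forall>y\<in>L. \<forall>z\<in>L. m (m x x y) z y = m x z y)"

definition H7 :: "'a set \<Rightarrow> ('a \<Rightarrow> 'a \<Rightarrow> 'a \<Rightarrow> 'a) \<Rightarrow> bool" where
  "H7 L m \<longleftrightarrow> (\<forall>x\<in>L. \<forall>y\<in>L. \<forall>z\<in>L. m x (m x x y) z = m x x z)"

definition H8 :: "'a set \<Rightarrow> ('a \<Rightarrow> 'a \<Rightarrow> 'a \<Rightarrow> 'a) \<Rightarrow> bool" where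
  "H8 L m \<longleftrightarrow> (\<forall>x\<in>L. \<forall>y\<in>L. \<forall>z\<in>L. \<forall>u\<in>L.
     m (m x (m y z u) u) (m x (m y z u) u) (m x z u) = m x z u)"

end

theory Submission
  imports Defs
begin

text \<open>
  Write \<open>x \<oplus> y\<close> for \<open>m x x y\<close> and \<open>x \<preceq> y\<close> for \<open>x \<oplus> y = y\<close>. In a nearlattice, \<open>m x y z\<close> is the greatest
  lower bound of \<open>x \<oplus> z\<close> and \<open>y \<oplus> z\<close> in the filter generated by \<open>z\<close>, and this description makes
  the five identities immediate: (H8) says that \<open>m x z u\<close> can only decrease when \<open>z\<close> is replaced
  by \<open>m y z u\<close>, which lies between \<open>u\<close> and \<open>z \<oplus> u\<close>.

  For the converse, (H1) and (H2) make \<open>\<preceq>\<close> reflexive and antisymmetric, (H7) computes \<open>m x y z\<close>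
  as \<open>x \<oplus> z\<close> whenever \<open>x \<preceq> y\<close>, and (H8) is the inequality
  \<open>m x (m y z u) u \<preceq> m x z u\<close>. The main work is to derive three facts before \<open>\<preceq>\<close> is known to be
  transitive:
    \<^item> \<open>m y u u = u\<close> (\<open>m_absorb\<close>), from which \<open>u \<preceq> m x z u\<close> follows and in particular
      \<open>u \<preceq> x \<oplus> u\<close>;
    \<^item> \<open>m x z u \<preceq> x \<oplus> u\<close> (\<open>m_le_join1\<close>), which is (H5);
    \<^item> \<open>m x (z \<oplus> u) u = m x z u\<close> (\<open>m_join_param\<close>), which up to (H4) is (H6).
  The last equation turns (H8) into plain monotonicity of \<open>m\<close>, by way of (H7): if \<open>z \<preceq> z'\<close>,
  then \<open>m z z' u = z \<oplus> u\<close>, so (H8) reads \<open>m x z u \<preceq> m x z' u\<close>. Transitivity of \<open>\<preceq>\<close>, the fact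
  that \<open>\<oplus>\<close> is the least upper bound (hence its associativity (H3)), and the fact that \<open>m x y z\<close>
  is the required greatest lower bound then follow from monotonicity and the three facts.

  Independence is shown by five simple models: a constant operation without (H1), a projection
  without (H2), a join that ignores the second argument without (H4), a mixture of join and
  projection on a chain without (H7), and the game of rock, paper, scissors, whose preference is
  not transitive, without (H8).
\<close>

section \<open>Nearlattices as semilattices with relative meets\<close>

text \<open>
  The relation between \<open>m\<close> and \<open>j\<close> that defines nearlattices, with the principal filters and
  the choice operator in their meets unfolded to bare inequalities.
\<close>

definition relative_meet_op :: "'a set \<Rightarrow> ('a \<Rightarrow> 'a \<Rightarrow> 'a) \<Rightarrow> ('a \<Rightarrow> 'a \<Rightarrow> 'a \<Rightarrow> 'a) \<Rightarrow> bool" where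
  "relative_meet_op L j m \<longleftrightarrow> (\<forall>x\<in>L. \<forall>y\<in>L. \<forall>z\<in>L.
     m x y z \<in> L \<and> join_le j z (m x y z) \<and>
     join_le j (m x y z) (j x z) \<and> join_le j (m x y z) (j y z) \<and>
     (\<forall>c\<in>L. join_le j z c \<longrightarrow> join_le j c (j x z) \<longrightarrow> join_le j c (j y z) \<longrightarrow>
        join_le j c (m x y z)))"

locale join_semilattice_on =
  fixes L :: "'a set" and j :: "'a \<Rightarrow> 'a \<Rightarrow> 'a"
  assumes join_semilattice: "join_semilattice L j"
begin

abbreviation less_eq :: "'a \<Rightarrow> 'a \<Rightarrow> bool" (infix "\<preceq>" 50) where
  "x \<preceq> y \<equiv> join_le j x y"

lemma join_in [simp]: "\<lbrakk>x \<in> L; y \<in> L\<rbrakk> \<Longrightarrow> j x y \<in> L"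
  and join_assoc: "\<lbrakk>x \<in> L; y \<in> L; z \<in> L\<rbrakk> \<Longrightarrow> j (j x y) z = j x (j y z)"
  and join_commute: "\<lbrakk>x \<in> L; y \<in> L\<rbrakk> \<Longrightarrow> j x y = j y x"
  and join_idem [simp]: "x \<in> L \<Longrightarrow> j x x = x"
  using join_semilattice unfolding join_semilattice_def by blast+

lemma le_refl [simp]: "x \<in> L \<Longrightarrow> x \<preceq> x"
  by (simp add: join_le_def)

lemma le_antisym: "\<lbrakk>x \<preceq> y; y \<preceq> x; x \<in> L; y \<in> L\<rbrakk> \<Longrightarrow> x = y"
  by (metis join_le_def join_commute)

lemma le_trans: "\<lbrakk>x \<preceq> y; y \<preceq> z; x \<in> L; y \<in> L; z \<in> L\<rbrakk> \<Longrightarrow> x \<preceq> z"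
  by (metis join_le_def join_assoc)

lemma join_upper1: "\<lbrakk>x \<in> L; y \<in> L\<rbrakk> \<Longrightarrow> x \<preceq> j x y"
  by (metis join_le_def join_assoc join_idem)

lemma join_upper2: "\<lbrakk>x \<in> L; y \<in> L\<rbrakk> \<Longrightarrow> y \<preceq> j x y"
  by (metis join_upper1 join_commute)

lemma join_least: "\<lbrakk>x \<preceq> z; y \<preceq> z; x \<in> L; y \<in> L; z \<in> L\<rbrakk> \<Longrightarrow> j x y \<preceq> z"
  by (simp add: join_le_def join_assoc)

lemma partial_order_principal_filter: "partial_order (principal_filter L j a)"
  by unfold_locales
     (auto simp: principal_filter_def intro: le_antisym le_trans)

lemma greatest_Lower_principal_filter_iff:
  assumes "x \<in> L" "y \<in> L" "a \<preceq> x" "a \<preceq> y"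
  shows "greatest (principal_filter L j a) g (Lower (principal_filter L j a) {x, y}) \<longleftrightarrow>
     g \<in> L \<and> a \<preceq> g \<and> g \<preceq> x \<and> g \<preceq> y \<and>
     (\<forall>c\<in>L. a \<preceq> c \<longrightarrow> c \<preceq> x \<longrightarrow> c \<preceq> y \<longrightarrow> c \<preceq> g)"
  using assms by (auto simp: greatest_def Lower_def principal_filter_def)

lemma least_Upper_principal_filter:
  assumes "x \<in> L" "y \<in> L" "a \<in> L" "a \<preceq> x" "a \<preceq> y"
  shows "least (principal_filter L j a) (j x y) (Upper (principal_filter L j a) {x, y})"
  using assms join_upper1 [of x y] join_upper2 [of x y] le_trans [of a x "j x y"]
  by (auto simp: least_def Upper_def principal_filter_def intro: join_least)

lemma lattice_principal_filter:
  assumes a: "a \<in> L"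
    and meet_exists: "\<And>x y. \<lbrakk>x \<in> L; y \<in> L; a \<preceq> x; a \<preceq> y\<rbrakk> \<Longrightarrow>
      \<exists>g. greatest (principal_filter L j a) g (Lower (principal_filter L j a) {x, y})"
  shows "lattice (principal_filter L j a)"
proof -
  interpret partial_order "principal_filter L j a"
    by (rule partial_order_principal_filter)
  show ?thesis
  proof unfold_locales
    fix x y
    assume "x \<in> carrier (principal_filter L j a)" "y \<in> carrier (principal_filter L j a)"
    then have xy: "x \<in> L" "y \<in> L" "a \<preceq> x" "a \<preceq> y"
      by (auto simp: principal_filter_def)
    show "\<exists>s. least (principal_filter L j a) s (Upper (principal_filter L j a) {x, y})"
      using least_Upper_principal_filter [OF xy(1,2) a xy(3,4)] by blast
    show "\<exists>s. greatest (principal_filter L j a) s (Lower (principal_filter L j a) {x, y})"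
      using meet_exists [OF xy] .
  qed
qed

lemma meet_principal_filter_eq:
  assumes "greatest (principal_filter L j a) g (Lower (principal_filter L j a) {x, y})"
  shows "x \<sqinter>\<^bsub>principal_filter L j a\<^esub> y = g"
proof -
  interpret partial_order "principal_filter L j a"
    by (rule partial_order_principal_filter)
  show ?thesis
    unfolding meet_def inf_def using assms by (blast intro: some_equality greatest_unique)
qed

text \<open>
  The existence of meets in principal filters need not be stated separately on the left, because
  elements \<open>x\<close> and \<open>y\<close> above \<open>a\<close> satisfy \<open>x = j x a\<close> and \<open>y = j y a\<close>, so \<open>m x y a\<close> is their meet.
\<close>

lemma relative_meet_op_iff:
  "relative_meet_op L j m \<longleftrightarrow>
     order_nearlattice L j \<and> (\<forall>x\<in>L. \<forall>y\<in>L. \<forall>z\<in>L. m x y z = nearlattice_op L j x y z)"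
  (is "?meets \<longleftrightarrow> ?order \<and> ?op")
proof (intro iffI conjI)
  assume meets: ?meets
  have greatest: "greatest (principal_filter L j z) (m x y z)
      (Lower (principal_filter L j z) {j x z, j y z})" if "x \<in> L" "y \<in> L" "z \<in> L" for x y z
    using that meets
    by (subst greatest_Lower_principal_filter_iff) (auto simp: relative_meet_op_def join_upper2)
  show ?op
    by (simp add: nearlattice_op_def meet_principal_filter_eq [OF greatest])
  show ?order
    unfolding order_nearlattice_def
  proof (intro conjI ballI lattice_principal_filter join_semilattice)
    fix a x y assume *: "a \<in> L" "x \<in> L" "y \<in> L" "a \<preceq> x" "a \<preceq> y"
    then have "j x a = x" "j y a = y"
      by (metis join_le_def join_commute)+
    then show "\<exists>g. greatest (principal_filter L j a) g (Lower (principal_filter L j a) {x, y})"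
      using greatest [of x y a] * by auto
  qed
next
  assume "?order \<and> ?op"
  then have order: ?order and op: ?op by blast+
  show ?meets
    unfolding relative_meet_op_def
  proof (intro ballI)
    fix x y z assume xyz: "x \<in> L" "y \<in> L" "z \<in> L"
    interpret lattice "principal_filter L j z"
      using order xyz by (simp add: order_nearlattice_def)
    have "j x z \<in> carrier (principal_filter L j z)" "j y z \<in> carrier (principal_filter L j z)"
      using xyz by (simp_all add: principal_filter_def join_upper2)
    then have "greatest (principal_filter L j z) (m x y z)
        (Lower (principal_filter L j z) {j x z, j y z})"
      using inf_of_two_greatest xyz op by (simp add: nearlattice_op_def meet_def)
    then show "m x y z \<in> L \<and> z \<preceq> m x y z \<and> m x y z \<preceq> j x z \<and> m x y z \<preceq> j y z \<and>
        (\<forall>c\<in>L. z \<preceq> c \<longrightarrow> c \<preceq> j x z \<longrightarrow> c \<preceq> j y z \<longrightarrow> c \<preceq> m x y z)"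
      using xyz by (simp add: greatest_Lower_principal_filter_iff join_upper2)
  qed
qed

end

lemma nearlattice_iff_relative_meet_op:
  assumes "ternary_algebra L m"
  shows "nearlattice L m \<longleftrightarrow> (\<exists>j. join_semilattice L j \<and> relative_meet_op L j m)"
proof -
  have "join_semilattice L j \<and> relative_meet_op L j m \<longleftrightarrow>
      order_nearlattice L j \<and> (\<forall>x\<in>L. \<forall>y\<in>L. \<forall>z\<in>L. m x y z = nearlattice_op L j x y z)" for j
    using join_semilattice_on.relative_meet_op_iff [OF join_semilattice_on.intro, of L j m]
    by (auto simp: order_nearlattice_def)
  then show ?thesis
    using assms by (simp add: nearlattice_def)
qed


section \<open>The identities hold in nearlattices\<close>

lemma relative_meet_op_identities:
  assumes "join_semilattice L j" and meets: "relative_meet_op L j m"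
  shows "H1 L m" "H2 L m" "H4 L m" "H7 L m" "H8 L m"
proof -
  interpret join_semilattice_on L j by unfold_locales fact
  have in_L [simp]: "m x y z \<in> L" and above: "z \<preceq> m x y z"
    and below1: "m x y z \<preceq> j x z" and below2: "m x y z \<preceq> j y z"
    and greatest: "\<And>c. \<lbrakk>c \<in> L; z \<preceq> c; c \<preceq> j x z; c \<preceq> j y z\<rbrakk> \<Longrightarrow> c \<preceq> m x y z"
    if "x \<in> L" "y \<in> L" "z \<in> L" for x y z
    using that meets unfolding relative_meet_op_def by blast+
  have meet_eq: "m x y z = g" if "g \<in> L" "z \<preceq> g" "g \<preceq> j x z" "g \<preceq> j y z"
    "\<And>c. \<lbrakk>c \<in> L; z \<preceq> c; c \<preceq> j x z; c \<preceq> j y z\<rbrakk> \<Longrightarrow> c \<preceq> g"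
    "x \<in> L" "y \<in> L" "z \<in> L" for x y z g
  proof (rule le_antisym)
    show "m x y z \<preceq> g"
      using that(6-8) by (intro that(5)) (simp_all add: above below1 below2)
    show "g \<preceq> m x y z" using that by (auto intro: greatest)
  qed (use that in simp_all)
  have diag: "m x x z = j x z" if "x \<in> L" "z \<in> L" for x z
    using that by (intro meet_eq) (auto simp: join_upper2)
  show "H1 L m" by (simp add: H1_def diag)
  show "H2 L m" by (auto simp: H2_def diag intro: join_commute)
  show "H4 L m"
    unfolding H4_def by (auto intro!: meet_eq above below1 below2 greatest)
  show "H7 L m"
    unfolding H7_def
  proof (intro ballI)
    fix x y z assume xyz: "x \<in> L" "y \<in> L" "z \<in> L"
    have "j x z \<preceq> j (j x y) z"
      using xyz by (meson join_in join_least join_upper1 join_upper2 le_trans)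
    then show "m x (m x x y) z = m x x z"
      using xyz by (simp add: diag) (intro meet_eq, auto simp: join_upper2)
  qed
  show "H8 L m"
    unfolding H8_def
  proof (intro ballI)
    fix x y z u assume xyzu: "x \<in> L" "y \<in> L" "z \<in> L" "u \<in> L"
    have "j (m y z u) u = m y z u"
      using xyzu above [of y z u] by (metis in_L join_commute join_le_def)
    then have "m x (m y z u) u \<preceq> j z u"
      using xyzu below2 [of x "m y z u" u] below2 [of y z u]
      by (auto intro: le_trans [of _ "m y z u"])
    then have "m x (m y z u) u \<preceq> m x z u"
      using xyzu by (intro greatest [where c = "m x (m y z u) u"]) (simp_all add: above below1)
    then show "m (m x (m y z u) u) (m x (m y z u) u) (m x z u) = m x z u"
      using xyzu by (simp add: diag join_le_def)
  qed
qed


section \<open>The identities define nearlattices\<close>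

locale H12478_algebra =
  fixes L :: "'a set" and m :: "'a \<Rightarrow> 'a \<Rightarrow> 'a \<Rightarrow> 'a"
  assumes ternary_algebra: "ternary_algebra L m"
    and identities: "H1 L m" "H2 L m" "H4 L m" "H7 L m" "H8 L m"
begin

abbreviation join :: "'a \<Rightarrow> 'a \<Rightarrow> 'a" (infixl "\<oplus>" 65) where
  "x \<oplus> y \<equiv> m x x y"

abbreviation less_eq :: "'a \<Rightarrow> 'a \<Rightarrow> bool" (infix "\<preceq>" 50) where
  "x \<preceq> y \<equiv> join_le join x y"

lemma m_in [simp]: "\<lbrakk>x \<in> L; y \<in> L; z \<in> L\<rbrakk> \<Longrightarrow> m x y z \<in> L"
  using ternary_algebra by (simp add: ternary_algebra_def)

lemma join_idem [simp]: "x \<in> L \<Longrightarrow> x \<oplus> x = x"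
  using identities by (simp add: H1_def)

lemma join_commute: "\<lbrakk>x \<in> L; y \<in> L\<rbrakk> \<Longrightarrow> x \<oplus> y = y \<oplus> x"
  using identities by (auto simp: H2_def)

lemma m_commute: "\<lbrakk>x \<in> L; y \<in> L; z \<in> L\<rbrakk> \<Longrightarrow> m x y z = m y x z"
  using identities by (auto simp: H4_def)

text \<open>The reading of (H8) as an inequality; every inequality below is derived from it.\<close>

lemma m_le_m: "\<lbrakk>x \<in> L; y \<in> L; z \<in> L; u \<in> L\<rbrakk> \<Longrightarrow> m x (m y z u) u \<preceq> m x z u"
  using identities by (simp add: H8_def join_le_def)

lemma le_antisym: "\<lbrakk>x \<preceq> y; y \<preceq> x; x \<in> L; y \<in> L\<rbrakk> \<Longrightarrow> x = y"
  by (metis join_le_def join_commute)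

text \<open>
  (H7) for comparable arguments, read as the evaluation of a meet. Instances of (H8) become
  informative once their inner term is evaluated in this way.
\<close>

lemma m_eq_join: "\<lbrakk>x \<preceq> y; x \<in> L; y \<in> L; z \<in> L\<rbrakk> \<Longrightarrow> m x y z = x \<oplus> z"
  using identities unfolding H7_def join_le_def by metis

lemma m_join_right [simp]: "\<lbrakk>x \<in> L; y \<in> L; z \<in> L\<rbrakk> \<Longrightarrow> m x (x \<oplus> y) z = x \<oplus> z"
  using identities by (simp add: H7_def)

text \<open>
  Put \<open>f y = m y u u\<close>. By (H7), \<open>m u (y \<oplus> u) u = u\<close>, and (H8) with \<open>y \<oplus> u = m y y u\<close> inside
  turns this into \<open>u \<preceq> f y\<close>. Therefore commutativity of the join reduces the claim to
  \<open>f y \<oplus> u = u\<close>. Two instances of (H8) that bound each other show that \<open>f y\<close> can stand in for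
  \<open>u\<close> as the second argument of \<open>m x u u\<close>, for all \<open>x\<close>; taking \<open>x = f y\<close> gives
  \<open>f y \<oplus> u = m (f y) u u\<close>, and (H7) evaluates the right-hand side to \<open>u\<close> because \<open>u \<preceq> f y\<close>.
\<close>

lemma m_absorb [simp]:
  assumes [simp]: "y \<in> L" "u \<in> L"
  shows "m y u u = u"
proof -
  have le: "u \<preceq> m y u u" if [simp]: "y \<in> L" for y
  proof -
    have "m u (m y y u) u = u"
      using join_commute [of y u] by simp
    then show ?thesis
      using m_le_m [of u y y u] m_commute [of u y u] by simp
  qed
  let ?f = "m y u u"
  have f_f: "m u ?f u = u"
    using m_eq_join [OF le] by simp
  have m_f: "m x ?f u = m x u u" if [simp]: "x \<in> L" for x
  proof (rule le_antisym)
    show "m x ?f u \<preceq> m x u u" by (rule m_le_m) simp_all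
    show "m x u u \<preceq> m x ?f u" using m_le_m [of x u ?f u] f_f by simp
  qed simp_all
  have "?f \<oplus> u = m ?f u u"
    using m_f [of ?f] by simp
  also have "\<dots> = u"
    using f_f by (simp add: m_commute)
  finally show ?thesis
    using le [of y] join_commute [of u ?f] by (simp add: join_le_def)
qed

lemma le_m: "\<lbrakk>x \<in> L; z \<in> L; u \<in> L\<rbrakk> \<Longrightarrow> u \<preceq> m x z u"
  using m_le_m [of x u z u] m_absorb [of z u] m_commute [of u z u] by simp

lemma m_join_absorb [simp]: "\<lbrakk>x \<in> L; z \<in> L; u \<in> L\<rbrakk> \<Longrightarrow> m x z u \<oplus> u = m x z u"
  using le_m [of x z u] join_commute [of u "m x z u"] by (simp add: join_le_def)

text \<open>
  Meeting with \<open>x\<close> a second time changes nothing. The nontrivial inequality is (H8) applied to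
  \<open>m x z u\<close> itself in place of \<open>x\<close>, where the inner term collapses to \<open>m x z u\<close> too.
\<close>

lemma m_m_left [simp]:
  assumes [simp]: "x \<in> L" "z \<in> L" "u \<in> L"
  shows "m x (m x z u) u = m x z u"
proof (rule le_antisym)
  let ?w = "m x z u"
  show "m x ?w u \<preceq> ?w" by (rule m_le_m) simp_all
  have "m ?w (m z x u) u = ?w"
    by (simp add: m_commute [of z x u])
  then show "?w \<preceq> m x ?w u"
    using m_le_m [of ?w z x u] m_commute [of ?w x u] by simp
qed simp_all

lemma m_le_join1:
  assumes [simp]: "x \<in> L" "z \<in> L" "u \<in> L"
  shows "m x z u \<preceq> x \<oplus> u"
  using m_le_m [of x z x u] by (simp add: m_commute [of z x u])

lemma m_le_join2: "\<lbrakk>x \<in> L; z \<in> L; u \<in> L\<rbrakk> \<Longrightarrow> m x z u \<preceq> z \<oplus> u"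
  using m_le_join1 [of z x u] m_commute [of x z u] by simp

text \<open>
  (H7) turns \<open>m x z u \<preceq> z \<oplus> u\<close> into \<open>m (m x z u) (z \<oplus> u) u = m x z u\<close>. This is the inner
  term of an instance of (H8), which therefore bounds \<open>m x (m x z u) u = m x z u\<close> by
  \<open>m x (z \<oplus> u) u\<close>. The other inequality is (H8) with equal inner arguments.
\<close>

lemma m_join_param [simp]:
  assumes [simp]: "x \<in> L" "z \<in> L" "u \<in> L"
  shows "m x (z \<oplus> u) u = m x z u"
proof (rule le_antisym)
  show "m x (z \<oplus> u) u \<preceq> m x z u" by (rule m_le_m) simp_all
  have "m (m x z u) (z \<oplus> u) u = m x z u"
    using m_eq_join [OF m_le_join2, of x z u u] by simp
  then show "m x z u \<preceq> m x (z \<oplus> u) u"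
    using m_le_m [of x "m x z u" "z \<oplus> u" u] by simp
qed simp_all

lemma m_join_param_left: "\<lbrakk>x \<in> L; z \<in> L; u \<in> L\<rbrakk> \<Longrightarrow> m (x \<oplus> u) z u = m x z u"
  by (simp add: m_commute [of _ z u])

text \<open>By (H7) the inner term of (H8) is now \<open>z \<oplus> u\<close>, which acts like \<open>z\<close> by the preceding lemma.\<close>

lemma m_mono: "\<lbrakk>z \<preceq> z'; x \<in> L; z \<in> L; z' \<in> L; u \<in> L\<rbrakk> \<Longrightarrow> m x z u \<preceq> m x z' u"
  using m_le_m [of x z z' u] by (simp add: m_eq_join)

text \<open>
  Monotonicity of the meet gives that of the join, since \<open>z \<oplus> u = m z' z u\<close> and
  \<open>z' \<oplus> u = m z' z' u\<close>.
\<close>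

lemma join_mono: "\<lbrakk>z \<preceq> z'; z \<in> L; z' \<in> L; u \<in> L\<rbrakk> \<Longrightarrow> z \<oplus> u \<preceq> z' \<oplus> u"
  using m_mono [of z z' z' u] m_commute [of z z' u] by (simp add: m_eq_join)

lemma join_upper2: "\<lbrakk>x \<in> L; y \<in> L\<rbrakk> \<Longrightarrow> y \<preceq> x \<oplus> y"
  by (rule le_m)

lemma join_upper1: "\<lbrakk>x \<in> L; y \<in> L\<rbrakk> \<Longrightarrow> x \<preceq> x \<oplus> y"
  by (metis join_upper2 join_commute)

lemma join_least: "\<lbrakk>x \<preceq> z; y \<preceq> z; x \<in> L; y \<in> L; z \<in> L\<rbrakk> \<Longrightarrow> x \<oplus> y \<preceq> z"
  using join_mono [of x z y] join_commute [of z y] by (simp add: join_le_def [of join y z])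

text \<open>If \<open>x \<preceq> y \<preceq> z\<close>, then \<open>x \<oplus> z \<preceq> y \<oplus> z = z\<close>, while \<open>z \<preceq> x \<oplus> z\<close> holds anyway.\<close>

lemma le_trans: "\<lbrakk>x \<preceq> y; y \<preceq> z; x \<in> L; y \<in> L; z \<in> L\<rbrakk> \<Longrightarrow> x \<preceq> z"
  using join_mono [of x y z] join_upper2 [of x z] le_antisym [of "x \<oplus> z" z]
  by (simp add: join_le_def [of join y z] join_le_def [of join x z])

lemma join_assoc:
  assumes [simp]: "x \<in> L" "y \<in> L" "z \<in> L"
  shows "(x \<oplus> y) \<oplus> z = x \<oplus> (y \<oplus> z)"
proof (rule le_antisym)
  have "y \<preceq> x \<oplus> (y \<oplus> z)" "z \<preceq> x \<oplus> (y \<oplus> z)"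
    using le_trans [OF join_upper1 join_upper2] le_trans [OF join_upper2 join_upper2] by simp_all
  then show "(x \<oplus> y) \<oplus> z \<preceq> x \<oplus> (y \<oplus> z)"
    by (simp add: join_least join_upper1)
  have "x \<preceq> (x \<oplus> y) \<oplus> z" "y \<preceq> (x \<oplus> y) \<oplus> z"
    using le_trans [OF join_upper1 join_upper1] le_trans [OF join_upper2 join_upper1] by simp_all
  then show "x \<oplus> (y \<oplus> z) \<preceq> (x \<oplus> y) \<oplus> z"
    by (simp add: join_least join_upper2)
qed simp_all

lemma join_semilattice_join: "join_semilattice L join"
  unfolding join_semilattice_def by (auto simp: join_assoc intro: join_commute)

text \<open>
  A lower bound \<open>c\<close> above \<open>z\<close> equals \<open>m c c z\<close>, and monotonicity lets one replace the two
  occurrences of \<open>c\<close>, one after the other, by \<open>x \<oplus> z\<close> and \<open>y \<oplus> z\<close>, that is, by \<open>x\<close> and \<open>y\<close>.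
\<close>

lemma relative_meet_op_m: "relative_meet_op L join m"
  unfolding relative_meet_op_def
proof (intro ballI conjI impI)
  fix x y z assume [simp]: "x \<in> L" "y \<in> L" "z \<in> L"
  show "m x y z \<in> L" "z \<preceq> m x y z" "m x y z \<preceq> x \<oplus> z" "m x y z \<preceq> y \<oplus> z"
    by (simp_all add: le_m m_le_join1 m_le_join2)
  fix c assume [simp]: "c \<in> L" and c: "z \<preceq> c" "c \<preceq> x \<oplus> z" "c \<preceq> y \<oplus> z"
  have "c = m c c z"
    using c(1) join_commute [of z c] by (simp add: join_le_def)
  also have "\<dots> \<preceq> m x c z"
    using m_mono [OF c(2), of c z] m_commute [of c x z] by simp
  finally have "c \<preceq> m x c z" .
  moreover have "m x c z \<preceq> m x y z"
    using m_mono [OF c(3), of x z] by simp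
  ultimately show "c \<preceq> m x y z"
    by (rule le_trans) simp_all
qed

lemma nearlattice: "nearlattice L m"
  using nearlattice_iff_relative_meet_op [OF ternary_algebra] join_semilattice_join
    relative_meet_op_m by blast

lemma H3: "H3 L m"
  by (simp add: H3_def join_assoc)

lemma H5: "H5 L m"
  using m_le_join1 by (simp add: H5_def join_le_def)

lemma H6: "H6 L m"
  by (simp add: H6_def m_join_param_left)

end


section \<open>Independence of the identities\<close>

text \<open>In (H2), (H4), (H7) and (H8) both sides are values of \<open>m\<close>, so a constant satisfies them.\<close>

lemma H1_independent:
  "\<exists>(L :: nat set) m. ternary_algebra L m \<and>
     \<not> H1 L m \<and> H2 L m \<and> H4 L m \<and> H7 L m \<and> H8 L m"
proof (intro exI)
  let ?m = "\<lambda>x y z :: nat. 0 :: nat"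
  show "ternary_algebra UNIV ?m \<and>
     \<not> H1 UNIV ?m \<and> H2 UNIV ?m \<and> H4 UNIV ?m \<and> H7 UNIV ?m \<and> H8 UNIV ?m"
    by (auto simp: ternary_algebra_def H1_def H2_def H4_def H7_def H8_def)
qed

text \<open>
  In (H1), (H4) and (H7) both sides end in the same variable, and the left-hand side of (H8) ends
  in its right-hand side; only (H2) exchanges the last argument.
\<close>

lemma H2_independent:
  "\<exists>(L :: nat set) m. ternary_algebra L m \<and>
     H1 L m \<and> \<not> H2 L m \<and> H4 L m \<and> H7 L m \<and> H8 L m"
proof (intro exI)
  let ?m = "\<lambda>x y z :: nat. z"
  show "ternary_algebra UNIV ?m \<and>
     H1 UNIV ?m \<and> \<not> H2 UNIV ?m \<and> H4 UNIV ?m \<and> H7 UNIV ?m \<and> H8 UNIV ?m"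
    by (auto simp: ternary_algebra_def H1_def H2_def H4_def H7_def H8_def)
qed

text \<open>
  Only (H4) can tell \<open>m x y z\<close> from \<open>m x x z\<close>: when the second argument is ignored, (H7) becomes
  trivial and (H8) reads \<open>x \<oplus> u \<preceq> x \<oplus> u\<close>.
\<close>

lemma H4_independent:
  "\<exists>(L :: nat set) m. ternary_algebra L m \<and>
     H1 L m \<and> H2 L m \<and> \<not> H4 L m \<and> H7 L m \<and> H8 L m"
proof (intro exI)
  let ?m = "\<lambda>x y z :: nat. max x z"
  have "?m 0 1 0 \<noteq> ?m 1 0 0" by simp
  then have "\<not> H4 UNIV ?m"
    unfolding H4_def by blast
  then show "ternary_algebra UNIV ?m \<and>
     H1 UNIV ?m \<and> H2 UNIV ?m \<and> \<not> H4 UNIV ?m \<and> H7 UNIV ?m \<and> H8 UNIV ?m"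
    by (auto simp: ternary_algebra_def H1_def H2_def H7_def H8_def)
qed

text \<open>
  Joins are those of a chain, but all meets of distinct elements above \<open>z\<close> are made as small as
  possible, namely \<open>z\<close>. Then (H7) fails, as the meet of \<open>1\<close> and \<open>2\<close> above \<open>0\<close> should be \<open>1\<close>. In
  (H8), a value \<open>u\<close> on the left is below everything of the form \<open>m x z u\<close>. The value is different
  only if \<open>x = m y z u\<close> exceeds \<open>u\<close>, which forces \<open>y = z = x\<close>, and then both sides agree.
\<close>

lemma H7_independent:
  "\<exists>(L :: nat set) m. ternary_algebra L m \<and>
     H1 L m \<and> H2 L m \<and> H4 L m \<and> \<not> H7 L m \<and> H8 L m"
proof (intro exI)
  let ?m = "\<lambda>x y z :: nat. if x = y then max x z else z"
  have "?m 1 (?m 1 1 2) 0 \<noteq> ?m 1 1 0" by simp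
  then have "\<not> H7 UNIV ?m"
    unfolding H7_def by blast
  then show "ternary_algebra UNIV ?m \<and>
     H1 UNIV ?m \<and> H2 UNIV ?m \<and> H4 UNIV ?m \<and> \<not> H7 UNIV ?m \<and> H8 UNIV ?m"
    by (auto simp: ternary_algebra_def H1_def H2_def H4_def H8_def max_def)
qed

text \<open>
  With the winner of rock, paper, scissors as join and the loser as meet, \<open>m x y z\<close> is the join of
  \<open>z\<close> with the meet of \<open>x\<close> and \<open>y\<close>. The other four identities involve only comparisons between
  two elements and the absorption of \<open>x \<oplus> y\<close> by \<open>x\<close>, which hold as in a chain. But with (H8) the
  relation \<open>\<preceq>\<close> would be transitive, and here it is a cycle.
\<close>

lemma H8_independent:
  "\<exists>(L :: nat set) m. ternary_algebra L m \<and>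
     H1 L m \<and> H2 L m \<and> H4 L m \<and> H7 L m \<and> \<not> H8 L m"
proof (intro exI)
  let ?L = "{0, 1, 2 :: nat}"
  let ?beats = "\<lambda>x y :: nat. x = (y + 1) mod 3"
  let ?winner = "\<lambda>x y. if ?beats y x then y else x"
  let ?loser = "\<lambda>x y. if ?beats y x then x else y"
  let ?m = "\<lambda>x y z. ?winner (?loser x y) z"
  have "?m (?m 0 (?m 2 0 1) 1) (?m 0 (?m 2 0 1) 1) (?m 0 0 1) \<noteq> ?m 0 0 1"
    by simp
  then have "\<not> H8 ?L ?m"
    unfolding H8_def by blast
  then show "ternary_algebra ?L ?m \<and>
     H1 ?L ?m \<and> H2 ?L ?m \<and> H4 ?L ?m \<and> H7 ?L ?m \<and> \<not> H8 ?L ?m"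
    by (simp add: ternary_algebra_def H1_def H2_def H4_def H7_def)
qed


section \<open>The basis theorem\<close>

theorem theorem1p3:
  shows "(\<forall>(L :: 'a set) m. ternary_algebra L m \<longrightarrow>
            (nearlattice L m \<longleftrightarrow> H1 L m \<and> H2 L m \<and> H4 L m \<and> H7 L m \<and> H8 L m))
       \<and> (\<forall>(L :: 'a set) m. ternary_algebra L m \<longrightarrow>
            H1 L m \<and> H2 L m \<and> H4 L m \<and> H7 L m \<and> H8 L m \<longrightarrow> H3 L m \<and> H5 L m \<and> H6 L m)
       \<and> (\<exists>(L :: nat set) m. ternary_algebra L m \<and>
            \<not> H1 L m \<and> H2 L m \<and> H4 L m \<and> H7 L m \<and> H8 L m)
       \<and> (\<exists>(L :: nat set) m. ternary_algebra L m \<and>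
            H1 L m \<and> \<not> H2 L m \<and> H4 L m \<and> H7 L m \<and> H8 L m)
       \<and> (\<exists>(L :: nat set) m. ternary_algebra L m \<and>
            H1 L m \<and> H2 L m \<and> \<not> H4 L m \<and> H7 L m \<and> H8 L m)
       \<and> (\<exists>(L :: nat set) m. ternary_algebra L m \<and>
            H1 L m \<and> H2 L m \<and> H4 L m \<and> \<not> H7 L m \<and> H8 L m)
       \<and> (\<exists>(L :: nat set) m. ternary_algebra L m \<and>
            H1 L m \<and> H2 L m \<and> H4 L m \<and> H7 L m \<and> \<not> H8 L m)"
proof (intro conjI)
  show "\<forall>(L :: 'a set) m. ternary_algebra L m \<longrightarrow>
      (nearlattice L m \<longleftrightarrow> H1 L m \<and> H2 L m \<and> H4 L m \<and> H7 L m \<and> H8 L m)"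
  proof (intro allI impI iffI)
    fix L :: "'a set" and m
    assume "ternary_algebra L m" "nearlattice L m"
    then obtain j where "join_semilattice L j" "relative_meet_op L j m"
      using nearlattice_iff_relative_meet_op by blast
    then show "H1 L m \<and> H2 L m \<and> H4 L m \<and> H7 L m \<and> H8 L m"
      by (simp add: relative_meet_op_identities)
  next
    fix L :: "'a set" and m
    assume "ternary_algebra L m" "H1 L m \<and> H2 L m \<and> H4 L m \<and> H7 L m \<and> H8 L m"
    then interpret H12478_algebra L m by unfold_locales auto
    show "nearlattice L m" by (rule nearlattice)
  qed
next
  show "\<forall>(L :: 'a set) m. ternary_algebra L m \<longrightarrow>
      H1 L m \<and> H2 L m \<and> H4 L m \<and> H7 L m \<and> H8 L m \<longrightarrow> H3 L m \<and> H5 L m \<and> H6 L m"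
  proof (intro allI impI)
    fix L :: "'a set" and m
    assume "ternary_algebra L m" "H1 L m \<and> H2 L m \<and> H4 L m \<and> H7 L m \<and> H8 L m"
    then interpret H12478_algebra L m by unfold_locales auto
    show "H3 L m \<and> H5 L m \<and> H6 L m" using H3 H5 H6 by blast
  qed
qed (rule H1_independent H2_independent H4_independent H7_independent H8_independent)+

end
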